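(* Let $Y$ and $Z$ be topological spaces. The following statements are true. (1) If $Y$ is a regular locally compact space, then the topologies $t^Z_{co}$, $t^Z_1$ and $t^Z_{1,s}$ on $C(Y,Z)$ are admissible. (2) If $Y$ is a corecompact space, then the topologies $t^Z_1$ and $t^Z_{1,s}$ on $C(Y,Z)$ are admissible. (3) If $Y$ is a locally bounded space, then the topology $t^Z_{1,s}$ on $C(Y,Z)$ is admissible.
   Context: For a topological space $X$, $\mathcal{O}(X)$ denotes the family of all open subsets of $X$. $C(Y,Z)$ is the set of all continuous maps from $Y$ to $Z$, and $\mathcal{O}_Z(Y)=\{f^{-1}(U): f\in C(Y,Z),\ U\in\mathcal{O}(Z)\}$. $\tau_Y^Z$ is the topology on $Y$ having $\mathcal{O}_Z(Y)$ as a subbasis. A subset $K\subseteq Y$ is $Z$-compact if it is compact in $(Y,\tau_Y^Z)$. The topology $t_{co}^Z$ on $C(Y,Z)$ has as a subbasis all sets $(K,U)=\{f\in C(Y,Z): f(K)\subseteq U\}$ with $K\subseteq Y$ $Z$-compact and $U\in\mathcal{O}(Z)$. $\tau_1^Z$ is the family of all $\mathbb{H}\subseteq\mathcal{O}(Y)$ such that: ($\alpha$) if $A\in\mathbb{H}\cap\mathcal{O}_Z(Y)$, $V\in\mathcal{O}(Y)$ and $A\subseteq V$, then $V\in\mathbb{H}$; and ($\beta$) every collection of elements of $\mathcal{O}_Z(Y)$ whose union belongs to $\mathbb{H}$ has a finite subcollection whose union belongs to $\mathbb{H}$. $\tau_{1,s}^Z$ is the family of all $\mathbb{H}\subseteq\mathcal{O}(Y)$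 satisfying ($\alpha$) and: ($\beta'$) every collection of elements of $\mathcal{O}_Z(Y)$ whose union equals $Y$ has a finite subcollection whose union belongs to $\mathbb{H}$. The topology $t_1^Z$ (respectively $t_{1,s}^Z$) on $C(Y,Z)$ has as a subbasis all sets $(\mathbb{H},U)=\{f\in C(Y,Z): f^{-1}(U)\in\mathbb{H}\}$ with $\mathbb{H}\in\tau_1^Z$ (respectively $\mathbb{H}\in\tau_{1,s}^Z$) and $U\in\mathcal{O}(Z)$. A topology $t$ on $C(Y,Z)$ is admissible if for every space $X$ and every map $G:X\to C(Y,Z)$, continuity of $G:X\to (C(Y,Z),t)$ implies continuity of $\widetilde{G}:X\times Y\to Z$, $\widetilde{G}(x,y)=G(x)(y)$; equivalently, the evaluation map $e:(C(Y,Z),t)\times Y\to Z$, $e(f,y)=f(y)$, is continuous. A subset $K$ of a space $X$ is bounded (in $X$) if every open cover of $X$ has a finite subcollection covering $K$. A space $X$ is corecompact if for every $x\in X$ and every open neighborhood $U$ of $x$ there is an open neighborhood $V$ of $x$ with $V\subseteq U$ and $V$ bounded in the space $U$. A space $X$ is locally bounded if for every $x\in X$ and every open neighborhood $U$ of $x$ there is a bounded open neighborhood $V$ of $x$ with $V\subseteq U$. *)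

theory Defs
  imports "HOL-Analysis.Analysis"
begin

(* The carrier is always open, being the empty intersection of subbasic sets, even if the
   subbasis does not cover it (e.g. when there are no continuous maps at all). *)
definition subbasis_topology :: "'a set \<Rightarrow> 'a set set \<Rightarrow> 'a topology" where
  "subbasis_topology S B =
     topology (arbitrary union_of (finite intersection_of (\<lambda>A. A \<in> B) relative_to S))"

lemma topspace_subbasis_topology [simp]: "topspace (subbasis_topology S B) = S"
  by (simp add: subbasis_topology_def)

(* Restricting to extensional functions makes each map on the carrier of Y have exactly one
   representative. *)
definition cont_maps :: "'a topology \<Rightarrow> 'b topology \<Rightarrow> ('a \<Rightarrow> 'b) set" where
  "cont_maps Y Z = {f \<in> extensional (topspace Y). continuous_map Y Z f}"

definition preimage :: "'a topology \<Rightarrow> ('a \<Rightarrow> 'b) \<Rightarrow> 'b set \<Rightarrow> 'a set" where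
  "preimage Y f U = {y \<in> topspace Y. f y \<in> U}"

definition Z_opens :: "'a topology \<Rightarrow> 'b topology \<Rightarrow> 'a set set" where
  "Z_opens Y Z = {preimage Y f U | f U. f \<in> cont_maps Y Z \<and> openin Z U}"

definition Z_topology :: "'a topology \<Rightarrow> 'b topology \<Rightarrow> 'a topology" where
  "Z_topology Y Z = subbasis_topology (topspace Y) (Z_opens Y Z)"

definition Z_compact :: "'a topology \<Rightarrow> 'b topology \<Rightarrow> 'a set \<Rightarrow> bool" where
  "Z_compact Y Z K \<longleftrightarrow> compactin (Z_topology Y Z) K"

definition t_co :: "'a topology \<Rightarrow> 'b topology \<Rightarrow> ('a \<Rightarrow> 'b) topology" where
  "t_co Y Z = subbasis_topology (cont_maps Y Z)
     {{f \<in> cont_maps Y Z. f ` K \<subseteq> U} | K U. Z_compact Y Z K \<and> openin Z U}"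

definition cond_alpha :: "'a topology \<Rightarrow> 'b topology \<Rightarrow> 'a set set \<Rightarrow> bool" where
  "cond_alpha Y Z \<H> \<longleftrightarrow>
     (\<forall>A V. A \<in> \<H> \<inter> Z_opens Y Z \<and> openin Y V \<and> A \<subseteq> V \<longrightarrow> V \<in> \<H>)"

definition cond_beta :: "'a topology \<Rightarrow> 'b topology \<Rightarrow> 'a set set \<Rightarrow> bool" where
  "cond_beta Y Z \<H> \<longleftrightarrow>
     (\<forall>\<A>. \<A> \<subseteq> Z_opens Y Z \<and> \<Union>\<A> \<in> \<H> \<longrightarrow>
        (\<exists>\<F>. finite \<F> \<and> \<F> \<subseteq> \<A> \<and> \<Union>\<F> \<in> \<H>))"

definition cond_beta' :: "'a topology \<Rightarrow> 'b topology \<Rightarrow> 'a set set \<Rightarrow> bool" where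
  "cond_beta' Y Z \<H> \<longleftrightarrow>
     (\<forall>\<A>. \<A> \<subseteq> Z_opens Y Z \<and> \<Union>\<A> = topspace Y \<longrightarrow>
        (\<exists>\<F>. finite \<F> \<and> \<F> \<subseteq> \<A> \<and> \<Union>\<F> \<in> \<H>))"

definition tau_1 :: "'a topology \<Rightarrow> 'b topology \<Rightarrow> 'a set set set" where
  "tau_1 Y Z = {\<H>. (\<forall>A \<in> \<H>. openin Y A) \<and> cond_alpha Y Z \<H> \<and> cond_beta Y Z \<H>}"

definition tau_1s :: "'a topology \<Rightarrow> 'b topology \<Rightarrow> 'a set set set" where
  "tau_1s Y Z = {\<H>. (\<forall>A \<in> \<H>. openin Y A) \<and> cond_alpha Y Z \<H> \<and> cond_beta' Y Z \<H>}"

definition t_1 :: "'a topology \<Rightarrow> 'b topology \<Rightarrow> ('a \<Rightarrow> 'b) topology" where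
  "t_1 Y Z = subbasis_topology (cont_maps Y Z)
     {{f \<in> cont_maps Y Z. preimage Y f U \<in> \<H>} | \<H> U. \<H> \<in> tau_1 Y Z \<and> openin Z U}"

definition t_1s :: "'a topology \<Rightarrow> 'b topology \<Rightarrow> ('a \<Rightarrow> 'b) topology" where
  "t_1s Y Z = subbasis_topology (cont_maps Y Z)
     {{f \<in> cont_maps Y Z. preimage Y f U \<in> \<H>} | \<H> U. \<H> \<in> tau_1s Y Z \<and> openin Z U}"

lemma topspace_function_space [simp]:
  "topspace (t_co Y Z) = cont_maps Y Z"
  "topspace (t_1 Y Z) = cont_maps Y Z"
  "topspace (t_1s Y Z) = cont_maps Y Z"
  by (simp_all add: t_co_def t_1_def t_1s_def)

(* HOL cannot quantify over types inside a formula, so the type of points of the test spaces X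
   is a parameter; a theorem with a free type variable in this place speaks about all spaces X.
   The two lemmas below show that this amounts to continuity of the evaluation map. *)
definition admissible ::
  "'x itself \<Rightarrow> 'a topology \<Rightarrow> 'b topology \<Rightarrow> ('a \<Rightarrow> 'b) topology \<Rightarrow> bool" where
  "admissible (T :: 'x itself) Y Z t \<longleftrightarrow>
     topspace t = cont_maps Y Z \<and>
     (\<forall>(X :: 'x topology) G. continuous_map X t G \<longrightarrow>
        continuous_map (prod_topology X Y) Z (\<lambda>(x, y). G x y))"

lemma admissible_if_evaluation:
  assumes "topspace t = cont_maps Y Z"
    and "continuous_map (prod_topology t Y) Z (\<lambda>(f, y). f y)"
  shows "admissible TYPE('x) Y Z t"
  unfolding admissible_def
proof (intro conjI allI impI)
  show "topspace t = cont_maps Y Z" by fact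
next
  fix X :: "'x topology" and G
  assume "continuous_map X t G"
  then have "continuous_map (prod_topology X Y) (prod_topology t Y) (\<lambda>p. (G (fst p), snd p))"
    by (intro continuous_map_pairedI continuous_map_compose[OF continuous_map_fst, unfolded o_def]
        continuous_map_snd)
  from continuous_map_compose[OF this assms(2)]
  show "continuous_map (prod_topology X Y) Z (\<lambda>(x, y). G x y)"
    by (simp add: o_def case_prod_unfold)
qed

lemma admissible_iff_evaluation:
  fixes Y :: "'a topology" and Z :: "'b topology"
  shows "admissible TYPE('a \<Rightarrow> 'b) Y Z t \<longleftrightarrow>
    topspace t = cont_maps Y Z \<and> continuous_map (prod_topology t Y) Z (\<lambda>(f, y). f y)"
proof
  assume adm: "admissible TYPE('a \<Rightarrow> 'b) Y Z t"
  have "continuous_map t t (\<lambda>f. f)" by simp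
  with adm show "topspace t = cont_maps Y Z \<and>
      continuous_map (prod_topology t Y) Z (\<lambda>(f, y). f y)"
    unfolding admissible_def by blast
qed (simp add: admissible_if_evaluation)

definition bounded_in :: "'a topology \<Rightarrow> 'a set \<Rightarrow> bool" where
  "bounded_in X K \<longleftrightarrow> K \<subseteq> topspace X \<and>
     (\<forall>\<U>. (\<forall>U \<in> \<U>. openin X U) \<and> \<Union>\<U> = topspace X \<longrightarrow>
        (\<exists>\<F>. finite \<F> \<and> \<F> \<subseteq> \<U> \<and> K \<subseteq> \<Union>\<F>))"

definition corecompact_space :: "'a topology \<Rightarrow> bool" where
  "corecompact_space X \<longleftrightarrow>
     (\<forall>x U. openin X U \<and> x \<in> U \<longrightarrow>
        (\<exists>V. openin X V \<and> x \<in> V \<and> V \<subseteq> U \<and> bounded_in (subtopology X U) V))"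

definition locally_bounded_space :: "'a topology \<Rightarrow> bool" where
  "locally_bounded_space X \<longleftrightarrow>
     (\<forall>x U. openin X U \<and> x \<in> U \<longrightarrow>
        (\<exists>V. openin X V \<and> x \<in> V \<and> V \<subseteq> U \<and> bounded_in X V))"

end

theory Submission
  imports Defs
begin

text \<open>
  Evaluation is continuous at \<open>(f, y)\<close> as soon as, for every open \<open>O\<close> containing \<open>f y\<close>, some open
  neighbourhood of \<open>f\<close> consists of maps sending a fixed neighbourhood \<open>V\<close> of \<open>y\<close> into \<open>O\<close>. For the
  compact-open topology take \<open>(K, O)\<close> with \<open>K\<close> a compact neighbourhood of \<open>y\<close>; otherwise
  take \<open>(\<H>, O)\<close>, where \<open>\<H>\<close> consists of the open supersets of a bounded \<open>V\<close> (locally bounded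
  case) or of the open \<open>W\<close> in which \<open>V\<close> is bounded (corecompact case). The latter is Scott
  open because the relation ``\<open>V\<close> is bounded in \<open>W\<close>'' interpolates in a corecompact space.
\<close>

section \<open>Subbasic open sets and the coarser topology \<open>Z_topology\<close>\<close>

lemma openin_subbasis_topology_inc:
  assumes "A \<in> B" "A \<subseteq> S"
  shows "openin (subbasis_topology S B) A"
proof -
  \<comment> \<open>Generators enter the base only as traces on \<open>S\<close>; for
    \<open>A \<subseteq> S\<close> the trace is \<open>A\<close> itself.\<close>
  have "(finite intersection_of (\<lambda>A. A \<in> B) relative_to S) (S \<inter> A)"
    using assms(1) by (intro relative_to_inc finite_intersection_of_inc)
  moreover have "S \<inter> A = A" using assms(2) by blast
  ultimately show ?thesis
    unfolding subbasis_topology_def openin_subbase by (simp add: arbitrary_union_of_inc)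
qed

lemma openin_Z_opens: "A \<in> Z_opens Y Z \<Longrightarrow> openin Y A"
  by (auto simp: Z_opens_def preimage_def cont_maps_def continuous_map_def)

lemma openin_Z_topology_imp_openin:
  assumes "openin (Z_topology Y Z) W"
  shows "openin Y W"
  using assms unfolding Z_topology_def subbasis_topology_def
  by (rule minimal_topology_subbase[rotated 2]) (simp_all add: openin_Z_opens)

text \<open>\<open>Z_topology Y Z\<close> is coarser than \<open>Y\<close>, so it has fewer open
  covers to test. This makes compact neighbourhoods in \<open>Y\<close> usable in subbasic sets of
  \<open>t_co\<close>.\<close>

lemma compactin_imp_Z_compact:
  assumes "compactin Y K"
  shows "Z_compact Y Z K"
  unfolding Z_compact_def compactin_def
proof (intro conjI allI impI)
  show "K \<subseteq> topspace (Z_topology Y Z)"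
    using compactin_subset_topspace[OF assms] by (simp add: Z_topology_def)
next
  fix \<U> assume "(\<forall>U \<in> \<U>. openin (Z_topology Y Z) U) \<and> K \<subseteq> \<Union>\<U>"
  then have "(\<forall>U \<in> \<U>. openin Y U) \<and> K \<subseteq> \<Union>\<U>"
    using openin_Z_topology_imp_openin by blast
  then show "\<exists>\<F>. finite \<F> \<and> \<F> \<subseteq> \<U> \<and> K \<subseteq> \<Union>\<F>"
    using assms unfolding compactin_def by blast
qed

lemma preimage_mem_Z_opens:
  assumes "f \<in> cont_maps Y Z" "openin Z U"
  shows "preimage Y f U \<in> Z_opens Y Z"
  using assms by (auto simp: Z_opens_def)

section \<open>Boundedness inside open subspaces\<close>

lemma bounded_in_subtopology:
  assumes "openin Y W"
  shows "bounded_in (subtopology Y W) V \<longleftrightarrow> V \<subseteq> W \<and>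
    (\<forall>\<U>. (\<forall>U \<in> \<U>. openin Y U) \<and> W \<subseteq> \<Union>\<U> \<longrightarrow>
       (\<exists>\<F>. finite \<F> \<and> \<F> \<subseteq> \<U> \<and> V \<subseteq> \<Union>\<F>))"
    (is "?L \<longleftrightarrow> ?R")
proof -
  have W: "topspace (subtopology Y W) = W"
    using openin_subset[OF assms] by (rule topspace_subtopology_subset)
  have op: "openin (subtopology Y W) U \<longleftrightarrow> openin Y U \<and> U \<subseteq> W" for U
    using assms by (simp add: openin_open_subtopology)
  show ?thesis
  proof
    assume L: ?L
    show ?R
    proof (intro conjI allI impI)
      show "V \<subseteq> W" using L by (simp add: bounded_in_def W)
    next
      fix \<U> assume \<U>: "(\<forall>U \<in> \<U>. openin Y U) \<and> W \<subseteq> \<Union>\<U>"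
      \<comment> \<open>Traces on \<open>W\<close> turn a cover that may stick out of
        \<open>W\<close> into one whose union is exactly \<open>W\<close>; a finite subfamily of
        traces then lifts back to \<open>\<U>\<close>.\<close>
      have "(\<forall>U \<in> (\<inter>) W ` \<U>. openin (subtopology Y W) U) \<and> \<Union>((\<inter>) W ` \<U>) = W"
        using \<U> assms by (auto simp: op)
      then obtain \<F> where "finite \<F>" "\<F> \<subseteq> (\<inter>) W ` \<U>" "V \<subseteq> \<Union>\<F>"
        using L unfolding bounded_in_def W by meson
      then obtain \<G> where "finite \<G>" "\<G> \<subseteq> \<U>" "V \<subseteq> \<Union>((\<inter>) W ` \<G>)"
        by (metis finite_subset_image)
      then show "\<exists>\<F>. finite \<F> \<and> \<F> \<subseteq> \<U> \<and> V \<subseteq> \<Union>\<F>"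
        by (intro exI[of _ \<G>]) auto
    qed
  next
    assume R: ?R
    show ?L
      unfolding bounded_in_def W op
    proof (intro conjI allI impI)
      show "V \<subseteq> W" using R by blast
    next
      fix \<U> assume "(\<forall>U \<in> \<U>. openin Y U \<and> U \<subseteq> W) \<and> \<Union>\<U> = W"
      then have "(\<forall>U \<in> \<U>. openin Y U) \<and> W \<subseteq> \<Union>\<U>" by blast
      with R show "\<exists>\<F>. finite \<F> \<and> \<F> \<subseteq> \<U> \<and> V \<subseteq> \<Union>\<F>" by meson
    qed
  qed
qed

text \<open>Every open cover of \<open>W'\<close> also covers \<open>W\<close>. This upward closure
  yields \<open>cond_alpha\<close> for the family used with \<open>t_1\<close>.\<close>

lemma bounded_in_subtopology_mono:
  assumes "bounded_in (subtopology Y W) V" "openin Y W" "openin Y W'" "W \<subseteq> W'"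
  shows "bounded_in (subtopology Y W') V"
  unfolding bounded_in_subtopology[OF assms(3)]
proof (intro conjI allI impI)
  show "V \<subseteq> W'"
    using assms(1,4) by (auto simp: bounded_in_subtopology[OF assms(2)])
next
  fix \<U> assume "(\<forall>U \<in> \<U>. openin Y U) \<and> W' \<subseteq> \<Union>\<U>"
  then have "(\<forall>U \<in> \<U>. openin Y U) \<and> W \<subseteq> \<Union>\<U>" using assms(4) by blast
  then show "\<exists>\<F>. finite \<F> \<and> \<F> \<subseteq> \<U> \<and> V \<subseteq> \<Union>\<F>"
    using assms(1) unfolding bounded_in_subtopology[OF assms(2)] by meson
qed

lemma bounded_in_subset:
  assumes "bounded_in X K" "L \<subseteq> K"
  shows "bounded_in X L"
  unfolding bounded_in_def
proof (intro conjI allI impI)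
  show "L \<subseteq> topspace X" using assms by (auto simp: bounded_in_def)
next
  fix \<U> assume "(\<forall>U \<in> \<U>. openin X U) \<and> \<Union>\<U> = topspace X"
  then obtain \<F> where "finite \<F>" "\<F> \<subseteq> \<U>" "K \<subseteq> \<Union>\<F>"
    using assms(1) unfolding bounded_in_def by meson
  then show "\<exists>\<F>. finite \<F> \<and> \<F> \<subseteq> \<U> \<and> L \<subseteq> \<Union>\<F>"
    using assms(2) by blast
qed

lemma bounded_in_subtopology_Union:
  assumes "finite \<V>" "\<And>V. V \<in> \<V> \<Longrightarrow> bounded_in (subtopology Y W) V" "openin Y W"
  shows "bounded_in (subtopology Y W) (\<Union>\<V>)"
  using assms(1,2)
proof (induction \<V>)
  case empty
  then show ?case using assms(3) by (auto simp: bounded_in_subtopology)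
next
  case (insert V \<V>)
  have V: "bounded_in (subtopology Y W) V" and \<V>: "bounded_in (subtopology Y W) (\<Union>\<V>)"
    using insert by auto
  show ?case
    unfolding bounded_in_subtopology[OF assms(3)]
  proof (intro conjI allI impI)
    show "\<Union>(insert V \<V>) \<subseteq> W"
      using V \<V> by (auto simp: bounded_in_subtopology[OF assms(3)])
  next
    fix \<U> assume \<U>: "(\<forall>U \<in> \<U>. openin Y U) \<and> W \<subseteq> \<Union>\<U>"
    obtain \<F> where "finite \<F>" "\<F> \<subseteq> \<U>" "V \<subseteq> \<Union>\<F>"
      using V \<U> unfolding bounded_in_subtopology[OF assms(3)] by meson
    moreover obtain \<G> where "finite \<G>" "\<G> \<subseteq> \<U>" "\<Union>\<V> \<subseteq> \<Union>\<G>"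
      using \<V> \<U> unfolding bounded_in_subtopology[OF assms(3)] by meson
    ultimately show "\<exists>\<F>. finite \<F> \<and> \<F> \<subseteq> \<U> \<and> \<Union>(insert V \<V>) \<subseteq> \<Union>\<F>"
      by (intro exI[of _ "\<F> \<union> \<G>"]) auto
  qed
qed

text \<open>Corecompactness applied twice puts around each point of \<open>A\<close> an open
  \<open>C\<close> bounded in some open \<open>B\<close> that is bounded in \<open>A\<close>.
  Finitely many such \<open>C\<close> cover \<open>V\<close>, and the union of their
  \<open>B\<close> serves as \<open>W\<close>.\<close>

lemma corecompact_interpolation:
  assumes "corecompact_space Y" "openin Y A" "bounded_in (subtopology Y A) V"
  obtains W where "openin Y W" "bounded_in (subtopology Y W) V" "bounded_in (subtopology Y A) W"
proof -
  define \<V> where "\<V> = {C. openin Y C \<and>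
    (\<exists>B. openin Y B \<and> bounded_in (subtopology Y B) C \<and> bounded_in (subtopology Y A) B)}"
  have "A \<subseteq> \<Union>\<V>"
  proof
    fix x assume "x \<in> A"
    then obtain B where B: "openin Y B" "x \<in> B" "bounded_in (subtopology Y A) B"
      using assms(1,2) unfolding corecompact_space_def by meson
    then obtain C where "openin Y C" "x \<in> C" "bounded_in (subtopology Y B) C"
      using assms(1) unfolding corecompact_space_def by meson
    with B show "x \<in> \<Union>\<V>" by (auto simp: \<V>_def)
  qed
  moreover have "\<forall>C \<in> \<V>. openin Y C" by (simp add: \<V>_def)
  ultimately obtain \<F> where \<F>: "finite \<F>" "\<F> \<subseteq> \<V>" "V \<subseteq> \<Union>\<F>"
    using assms(3) unfolding bounded_in_subtopology[OF assms(2)] by meson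
  then have "\<forall>C \<in> \<F>. \<exists>B. openin Y B \<and> bounded_in (subtopology Y B) C \<and>
      bounded_in (subtopology Y A) B"
    by (auto simp: \<V>_def)
  then obtain g where g: "\<And>C. C \<in> \<F> \<Longrightarrow> openin Y (g C) \<and> bounded_in (subtopology Y (g C)) C \<and>
      bounded_in (subtopology Y A) (g C)"
    by metis
  \<comment> \<open>Each \<open>C\<close> is bounded in its own \<open>g C\<close>, hence in the
    larger \<open>W\<close>; being a finite union, \<open>W\<close> stays bounded in
    \<open>A\<close>.\<close>
  define W where "W = \<Union>(g ` \<F>)"
  have oW: "openin Y W" using g by (auto simp: W_def)
  have "bounded_in (subtopology Y A) W"
    unfolding W_def using \<F>(1) g assms(2) by (intro bounded_in_subtopology_Union) auto
  moreover have "bounded_in (subtopology Y W) (\<Union>\<F>)"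
    using \<F>(1)
  proof (rule bounded_in_subtopology_Union[OF _ _ oW])
    fix C assume C: "C \<in> \<F>"
    then have "g C \<subseteq> W" by (auto simp: W_def)
    with g[OF C] oW show "bounded_in (subtopology Y W) C"
      using bounded_in_subtopology_mono by blast
  qed
  then have "bounded_in (subtopology Y W) V"
    using bounded_in_subset[OF _ \<F>(3)] by blast
  ultimately show thesis using that oW by blast
qed

section \<open>Relations between the three local conditions on \<open>Y\<close>\<close>

lemma corecompact_imp_locally_bounded:
  assumes "corecompact_space Y"
  shows "locally_bounded_space Y"
  unfolding locally_bounded_space_def
proof (intro allI impI)
  fix x U assume U: "openin Y U \<and> x \<in> U"
  then obtain V where "openin Y V" "x \<in> V" "V \<subseteq> U" "bounded_in (subtopology Y U) V"
    using assms unfolding corecompact_space_def by meson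
  \<comment> \<open>Boundedness passes from the subspace \<open>U\<close> to the largest open set,
    \<open>topspace Y\<close>, whose subspace topology is \<open>Y\<close>.\<close>
  moreover from this have "bounded_in Y V"
    using bounded_in_subtopology_mono[of Y U V "topspace Y"] U openin_subset[of Y U] by simp
  ultimately show "\<exists>V. openin Y V \<and> x \<in> V \<and> V \<subseteq> U \<and> bounded_in Y V" by blast
qed

text \<open>Local compactness only promises some compact neighbourhood of each point; regularity
  lets it shrink into any given open \<open>W\<close>.\<close>

lemma regular_locally_compact_nbhd:
  assumes "regular_space Y" "locally_compact_space Y" "openin Y W" "x \<in> W"
  obtains U K where "openin Y U" "compactin Y K" "x \<in> U" "U \<subseteq> K" "K \<subseteq> W"
proof -
  have "neighbourhood_base_of (\<lambda>C. compactin Y C \<and> closedin Y C) Y"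
    using assms(1,2) locally_compact_regular_space_neighbourhood_base by blast
  from this[unfolded neighbourhood_base_of, rule_format, OF conjI, OF assms(3,4)]
  show thesis using that by (elim exE conjE)
qed

lemma regular_locally_compact_imp_corecompact:
  assumes "regular_space Y" "locally_compact_space Y"
  shows "corecompact_space Y"
  unfolding corecompact_space_def
proof (intro allI impI)
  fix x W assume W: "openin Y W \<and> x \<in> W"
  then obtain U K where UK: "openin Y U" "compactin Y K" "x \<in> U" "U \<subseteq> K" "K \<subseteq> W"
    using regular_locally_compact_nbhd assms by metis
  \<comment> \<open>An open cover of \<open>W\<close> covers the compact \<open>K\<close>, and a
    finite subcover of \<open>K\<close> covers \<open>U\<close>.\<close>
  have "bounded_in (subtopology Y W) U"
    using UK W by (simp add: bounded_in_subtopology compactin_def) (meson order_trans)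
  with UK show "\<exists>V. openin Y V \<and> x \<in> V \<and> V \<subseteq> W \<and> bounded_in (subtopology Y W) V" by blast
qed

section \<open>Admissibility of the three topologies\<close>

lemma admissibleI_nbhd:
  assumes "topspace t = cont_maps Y Z"
    and nbhd: "\<And>f U y. \<lbrakk>f \<in> cont_maps Y Z; openin Z U; y \<in> preimage Y f U\<rbrakk> \<Longrightarrow>
      \<exists>N V. openin t N \<and> f \<in> N \<and> openin Y V \<and> y \<in> V \<and> (\<forall>g \<in> N. V \<subseteq> preimage Y g U)"
  shows "admissible TYPE('x) Y Z t"
proof (rule admissible_if_evaluation)
  show "continuous_map (prod_topology t Y) Z (\<lambda>(f, y). f y)"
    unfolding continuous_map_eq_topcontinuous_at topcontinuous_at_def
  proof (intro ballI conjI allI impI)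
    show "(\<lambda>(f, y). f y) \<in> topspace (prod_topology t Y) \<rightarrow> topspace Z"
      using assms(1) by (auto simp: cont_maps_def continuous_map_def)
  next
    fix p U assume p: "p \<in> topspace (prod_topology t Y)"
      and U: "openin Z U \<and> (case p of (f, y) \<Rightarrow> f y) \<in> U"
    obtain f y where fy: "p = (f, y)" "f \<in> cont_maps Y Z" "y \<in> preimage Y f U"
      using p U assms(1) by (cases p) (auto simp: preimage_def)
    then obtain N V where NV: "openin t N" "f \<in> N" "openin Y V" "y \<in> V"
        "\<forall>g \<in> N. V \<subseteq> preimage Y g U"
      using nbhd U by meson
    \<comment> \<open>The box \<open>N \<times> V\<close> is the neighbourhood of
      \<open>(f, y)\<close> that evaluation sends into \<open>U\<close>.\<close>
    then have "openin (prod_topology t Y) (N \<times> V)" by (simp add: openin_prod_Times_iff)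
    moreover have "\<forall>q \<in> N \<times> V. (case q of (f, y) \<Rightarrow> f y) \<in> U"
      using NV by (auto simp: preimage_def)
    ultimately show "\<exists>N. openin (prod_topology t Y) N \<and> p \<in> N \<and>
        (\<forall>q \<in> N. (case q of (f, y) \<Rightarrow> f y) \<in> U)"
      using NV fy by blast
  qed auto
qed (fact assms(1))

lemma regular_locally_compact_imp_admissible_t_co:
  assumes "regular_space Y" "locally_compact_space Y"
  shows "admissible TYPE('x) Y Z (t_co Y Z)"
proof (rule admissibleI_nbhd)
  fix f U y
  assume f: "f \<in> cont_maps Y Z" and U: "openin Z U" and y: "y \<in> preimage Y f U"
  obtain V K where VK: "openin Y V" "compactin Y K" "y \<in> V" "V \<subseteq> K" "K \<subseteq> preimage Y f U"
    using regular_locally_compact_nbhd[OF assms _ y]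
      openin_Z_opens[OF preimage_mem_Z_opens[OF f U]] by metis
  define N where "N = {g \<in> cont_maps Y Z. g ` K \<subseteq> U}"
  have "openin (t_co Y Z) N"
    unfolding t_co_def N_def using U compactin_imp_Z_compact[OF VK(2)]
    by (intro openin_subbasis_topology_inc) auto
  moreover have "f \<in> N" using f VK(5) by (auto simp: N_def preimage_def)
  moreover have "\<forall>g \<in> N. V \<subseteq> preimage Y g U"
    using VK(4,5) by (fastforce simp: N_def preimage_def)
  ultimately show "\<exists>N V. openin (t_co Y Z) N \<and> f \<in> N \<and> openin Y V \<and> y \<in> V \<and>
      (\<forall>g \<in> N. V \<subseteq> preimage Y g U)"
    using VK by blast
qed simp

lemma corecompact_imp_admissible_t_1:
  assumes "corecompact_space Y"
  shows "admissible TYPE('x) Y Z (t_1 Y Z)"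
proof (rule admissibleI_nbhd)
  fix f U y
  assume f: "f \<in> cont_maps Y Z" and U: "openin Z U" and y: "y \<in> preimage Y f U"
  have oA: "openin Y (preimage Y f U)"
    using openin_Z_opens[OF preimage_mem_Z_opens[OF f U]] .
  then obtain V where V: "openin Y V" "y \<in> V" "bounded_in (subtopology Y (preimage Y f U)) V"
    using assms y unfolding corecompact_space_def by meson
  define \<H> where "\<H> = {W. openin Y W \<and> bounded_in (subtopology Y W) V}"
  have "cond_alpha Y Z \<H>"
    unfolding cond_alpha_def \<H>_def using bounded_in_subtopology_mono by blast
  moreover have "cond_beta Y Z \<H>"
    unfolding cond_beta_def
  proof (intro allI impI)
    fix \<A> assume \<A>: "\<A> \<subseteq> Z_opens Y Z \<and> \<Union>\<A> \<in> \<H>"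
    then have op: "\<forall>A \<in> \<A>. openin Y A" using openin_Z_opens by blast
    have oU: "openin Y (\<Union>\<A>)" and bU: "bounded_in (subtopology Y (\<Union>\<A>)) V"
      using \<A> by (auto simp: \<H>_def)
    \<comment> \<open>Boundedness in \<open>\<Union>\<A>\<close> alone would only place
      \<open>V\<close> inside a finite subunion. Interpolation lets that subunion contain
      \<open>W\<close>, so \<open>V\<close> is even bounded in it.\<close>
    obtain W where W: "openin Y W" "bounded_in (subtopology Y W) V"
        "bounded_in (subtopology Y (\<Union>\<A>)) W"
      using corecompact_interpolation[OF assms oU bU] .
    then obtain \<F> where \<F>: "finite \<F>" "\<F> \<subseteq> \<A>" "W \<subseteq> \<Union>\<F>"
      using op unfolding bounded_in_subtopology[OF oU] by (meson order_refl)
    have "openin Y (\<Union>\<F>)" using \<F> op by blast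
    then have "\<Union>\<F> \<in> \<H>"
      using bounded_in_subtopology_mono[OF W(2,1) _ \<F>(3)] by (simp add: \<H>_def)
    with \<F> show "\<exists>\<F>. finite \<F> \<and> \<F> \<subseteq> \<A> \<and> \<Union>\<F> \<in> \<H>" by blast
  qed
  ultimately have \<H>: "\<H> \<in> tau_1 Y Z" by (simp add: tau_1_def \<H>_def)
  define N where "N = {g \<in> cont_maps Y Z. preimage Y g U \<in> \<H>}"
  have "openin (t_1 Y Z) N"
    unfolding t_1_def N_def using U \<H> by (intro openin_subbasis_topology_inc) auto
  moreover have "f \<in> N" using f V oA by (simp add: N_def \<H>_def)
  \<comment> \<open>A set bounded in a subspace lies in that subspace.\<close>
  moreover have "\<forall>g \<in> N. V \<subseteq> preimage Y g U"
    by (auto simp: N_def \<H>_def bounded_in_subtopology)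
  ultimately show "\<exists>N V. openin (t_1 Y Z) N \<and> f \<in> N \<and> openin Y V \<and> y \<in> V \<and>
      (\<forall>g \<in> N. V \<subseteq> preimage Y g U)"
    using V by blast
qed simp

lemma locally_bounded_imp_admissible_t_1s:
  assumes "locally_bounded_space Y"
  shows "admissible TYPE('x) Y Z (t_1s Y Z)"
proof (rule admissibleI_nbhd)
  fix f U y
  assume f: "f \<in> cont_maps Y Z" and U: "openin Z U" and y: "y \<in> preimage Y f U"
  have oA: "openin Y (preimage Y f U)"
    using openin_Z_opens[OF preimage_mem_Z_opens[OF f U]] .
  then obtain V where V: "openin Y V" "y \<in> V" "V \<subseteq> preimage Y f U" "bounded_in Y V"
    using assms y unfolding locally_bounded_space_def by meson
  \<comment> \<open>\<open>cond_beta'\<close> tests only covers of all of \<open>Y\<close>, so plain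
    containment of \<open>V\<close> suffices here: boundedness of \<open>V\<close> in
    \<open>Y\<close> supplies the finite subunion containing it.\<close>
  define \<H> where "\<H> = {W. openin Y W \<and> V \<subseteq> W}"
  have "cond_alpha Y Z \<H>"
    by (auto simp: cond_alpha_def \<H>_def)
  moreover have "cond_beta' Y Z \<H>"
    unfolding cond_beta'_def
  proof (intro allI impI)
    fix \<A> assume \<A>: "\<A> \<subseteq> Z_opens Y Z \<and> \<Union>\<A> = topspace Y"
    then have op: "\<forall>A \<in> \<A>. openin Y A" using openin_Z_opens by blast
    then obtain \<F> where \<F>: "finite \<F>" "\<F> \<subseteq> \<A>" "V \<subseteq> \<Union>\<F>"
      using V(4) \<A> unfolding bounded_in_def by meson
    have "openin Y (\<Union>\<F>)" using \<F> op by blast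
    with \<F> show "\<exists>\<F>. finite \<F> \<and> \<F> \<subseteq> \<A> \<and> \<Union>\<F> \<in> \<H>" by (auto simp: \<H>_def)
  qed
  ultimately have \<H>: "\<H> \<in> tau_1s Y Z" by (simp add: tau_1s_def \<H>_def)
  define N where "N = {g \<in> cont_maps Y Z. preimage Y g U \<in> \<H>}"
  have "openin (t_1s Y Z) N"
    unfolding t_1s_def N_def using U \<H> by (intro openin_subbasis_topology_inc) auto
  moreover have "f \<in> N" using f V oA by (simp add: N_def \<H>_def)
  moreover have "\<forall>g \<in> N. V \<subseteq> preimage Y g U" by (simp add: N_def \<H>_def)
  ultimately show "\<exists>N V. openin (t_1s Y Z) N \<and> f \<in> N \<and> openin Y V \<and> y \<in> V \<and>
      (\<forall>g \<in> N. V \<subseteq> preimage Y g U)"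
    using V by blast
qed simp

theorem theorem2p5:
  fixes Y :: "'a topology" and Z :: "'b topology"
  shows "(regular_space Y \<and> locally_compact_space Y \<longrightarrow>
            admissible TYPE('x) Y Z (t_co Y Z) \<and>
            admissible TYPE('x) Y Z (t_1 Y Z) \<and>
            admissible TYPE('x) Y Z (t_1s Y Z)) \<and>
         (corecompact_space Y \<longrightarrow>
            admissible TYPE('x) Y Z (t_1 Y Z) \<and>
            admissible TYPE('x) Y Z (t_1s Y Z)) \<and>
         (locally_bounded_space Y \<longrightarrow>
            admissible TYPE('x) Y Z (t_1s Y Z))"
  \<comment> \<open>Regular local compactness implies corecompactness, which implies local
    boundedness; so each hypothesis inherits the admissibility results of the weaker ones, and only
    \<open>t_co\<close> needs compact neighbourhoods.\<close>
  by (simp add: regular_locally_compact_imp_admissible_t_co corecompact_imp_admissible_t_1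
      locally_bounded_imp_admissible_t_1s corecompact_imp_locally_bounded
      regular_locally_compact_imp_corecompact)

end
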